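(* Let $0<\lambda<1$ and let $p(d)\in[0,1]$, $d\in\mathbb{N}$, satisfy $\sum_{d=0}^\infty p(d)=1$ and $\sum_{d=0}^\infty d\,p(d)<\infty$. Let $\varphi(x):=\sum_{d=0}^\infty x^dp(d)$ for $x\in[0,1]$, and define $q^*(0):=1$, $q^*(1):=\lambda$ and $q^*(i):=\lambda q^*(i-1)\varphi(q^*(i-1))$ for $i>1$. Then every fluid trajectory $q$ satisfies $$\lim_{t\to\infty}q(t,i)=q^*(i)\quad\text{for all } i\ge0.$$
   Context: $\mathbb{N}$ includes $0$; $\ell_1$ is the space of absolutely summable sequences in $\mathbb{R}^{\mathbb{N}}$. Let $$Q:=\{x\in\ell_1: 0\le x(i+1)\le x(i)\le x(0)=1\ \text{for all } i\ge1\}.$$ A fluid trajectory is a function $q:[0,\infty)\to Q$, written $q(t)=(q(t,i))_{i\in\mathbb{N}}$, whose coordinate functions are absolutely continuous on compact intervals and satisfy, for all $i\ge1$ and almost every $t$, $$\dot q(t,i)=\lambda\left[q(t,i-1)\varphi(q(t,i-1))-q(t,i)\varphi(q(t,i))\right]-\left[q(t,i)-q(t,i+1)\right].$$ *)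

theory Defs
  imports "HOL-Analysis.Analysis"
begin

text \<open>
  The predicate \<open>absolutely_continuous\<close> of HOL-Analysis is a relation between measures; the
  notion for real functions is defined here. The intervals may be degenerate, which contributes
  nothing to either sum.
\<close>

definition abs_continuous_on :: "real set \<Rightarrow> (real \<Rightarrow> real) \<Rightarrow> bool" where
  "abs_continuous_on S f \<longleftrightarrow>
     (\<forall>\<epsilon>>0. \<exists>\<delta>>0. \<forall>(n::nat) a b.
        (\<forall>k<n. a k \<le> b k \<and> {a k..b k} \<subseteq> S) \<and>
        disjoint_family_on (\<lambda>k. {a k<..<b k}) {..<n} \<and>
        (\<Sum>k<n. b k - a k) < \<delta>
        \<longrightarrow> (\<Sum>k<n. \<bar>f (b k) - f (a k)\<bar>) < \<epsilon>)"

definition occupancy_space :: "(nat \<Rightarrow> real) set" where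
  "occupancy_space =
     {x. summable (\<lambda>i. \<bar>x i\<bar>) \<and>
         (\<forall>i\<ge>1. 0 \<le> x (i + 1) \<and> x (i + 1) \<le> x i \<and> x i \<le> x 0 \<and> x 0 = 1)}"

text \<open>
  Functions on \<open>[0,\<infinity>)\<close> are represented by total functions on the reals whose values at negative
  times are unconstrained; hence the derivative is taken within \<open>[0,\<infinity>)\<close>.
\<close>

definition fluid_trajectory ::
    "real \<Rightarrow> (real \<Rightarrow> real) \<Rightarrow> (real \<Rightarrow> nat \<Rightarrow> real) \<Rightarrow> bool" where
  "fluid_trajectory lam \<phi> q \<longleftrightarrow>
     (\<forall>t\<ge>0. q t \<in> occupancy_space) \<and>
     (\<forall>i a b. 0 \<le> a \<and> a \<le> b \<longrightarrow> abs_continuous_on {a..b} (\<lambda>t. q t i)) \<and>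
     (\<forall>i\<ge>1. AE t in lebesgue. t \<ge> 0 \<longrightarrow>
        ((\<lambda>s. q s i) has_real_derivative
           lam * (q t (i - 1) * \<phi> (q t (i - 1)) - q t i * \<phi> (q t i))
           - (q t i - q t (i + 1))) (at t within {0..}))"

definition gen_fun :: "(nat \<Rightarrow> real) \<Rightarrow> real \<Rightarrow> real" where
  "gen_fun p x = (\<Sum>d. x ^ d * p d)"

fun q_star :: "real \<Rightarrow> (real \<Rightarrow> real) \<Rightarrow> nat \<Rightarrow> real" where
  "q_star lam \<phi> 0 = 1"
| "q_star lam \<phi> (Suc 0) = lam"
| "q_star lam \<phi> (Suc (Suc i)) = lam * q_star lam \<phi> (Suc i) * \<phi> (q_star lam \<phi> (Suc i))"

end

theory Submission
  imports Defs
begin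

text \<open>
  Write \<open>x\<^sub>i(t) = q(t,i) - q\<^sup>*(i)\<close>, \<open>f(x) = x \<phi>(x)\<close> and \<open>y\<^sub>i(t) = f(q(t,i)) - f(q\<^sup>*(i))\<close>. Since
  \<open>q\<^sup>*(i+1) = \<lambda> f(q\<^sup>*(i))\<close> for every \<open>i \<ge> 0\<close>, the point \<open>q\<^sup>*\<close> is an equilibrium, and
  \<open>x\<^sub>i' = \<lambda> (y\<^sub>i\<^sub>-\<^sub>1 - y\<^sub>i) - (x\<^sub>i - x\<^sub>i\<^sub>+\<^sub>1)\<close> for \<open>i \<ge> 1\<close>, with \<open>x\<^sub>0 = y\<^sub>0 = 0\<close>.

  The function \<open>f\<close> is increasing, so \<open>y\<^sub>i\<close> has the sign of \<open>x\<^sub>i\<close>. Multiplying by this sign gives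
  \<open>|x\<^sub>i|' \<le> \<lambda> (|y\<^sub>i\<^sub>-\<^sub>1| - |y\<^sub>i|) - (|x\<^sub>i| - |x\<^sub>i\<^sub>+\<^sub>1|)\<close>. The right-hand sides telescope, so that the
  \<open>\<ell>\<^sub>1\<close> distance to the equilibrium decreases at rate at least \<open>|x\<^sub>1|\<close>. Consequently
  \<open>\<integral>\<^sub>0\<^sup>\<infinity> |x\<^sub>1| \<le> \<Sum>\<^sub>i |x\<^sub>i(0)| < \<infinity>\<close>, which is \<open>integral_abs_dev_1_le\<close>.

  All coordinates and their rates of change are Lipschitz in time. Barbalat's lemma therefore
  turns the finite integral into \<open>x\<^sub>1 \<rightarrow> 0\<close>. It also shows that \<open>x\<^sub>i \<rightarrow> 0\<close> implies \<open>x\<^sub>i' \<rightarrow> 0\<close>;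
  solving the equation for \<open>x\<^sub>i\<^sub>+\<^sub>1\<close> then gives \<open>x\<^sub>i\<^sub>+\<^sub>1 \<rightarrow> 0\<close> as soon as \<open>x\<^sub>i\<^sub>-\<^sub>1\<close> and \<open>x\<^sub>i\<close> tend to \<open>0\<close>,
  and induction on \<open>i\<close> ends the proof (\<open>dev_tendsto_0\<close>).

  Two technical points remain. The differential equations hold only almost everywhere; absolute
  continuity turns them into integral equations
  (\<open>fundamental_theorem_of_calculus_abs_continuous\<close>), and as the right-hand sides are continuous,
  the equations then hold at every time. The kink of the absolute value is avoided by the
  approximation \<open>sqrt (x\<^sup>2 + \<epsilon>\<^sup>2)\<close>, whose error is controlled by the Lipschitz constant
  \<open>\<Sum>\<^sub>d (d+1) p(d)\<close> of \<open>f\<close>; this is where the finite mean of \<open>p\<close> enters.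
\<close>

section \<open>The fundamental theorem of calculus for absolutely continuous functions\<close>

(* Below, content is the content of a box. *)
hide_const (open) Polynomial.content

text \<open>
  Absolute continuity speaks of numbered families of intervals with endpoint sequences, gauge
  integration of finite sets of tagged intervals; this lemma translates between the two.
\<close>

lemma abs_continuous_on_tagged_partial_division:
  assumes f: "abs_continuous_on {a..b} f" and "e > 0"
  obtains d where "d > 0"
    "\<And>D. D tagged_partial_division_of {a..b} \<Longrightarrow> (\<Sum>(x,K)\<in>D. content K) < d \<Longrightarrow>
       (\<Sum>(x,K)\<in>D. \<bar>f (Sup K) - f (Inf K)\<bar>) < e"
proof -
  obtain d where "d > 0" and d: "\<And>(n::nat) l r.
        (\<forall>k<n. l k \<le> r k \<and> {l k..r k} \<subseteq> {a..b}) \<Longrightarrow>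
        disjoint_family_on (\<lambda>k. {l k<..<r k}) {..<n} \<Longrightarrow>
        (\<Sum>k<n. r k - l k) < d \<Longrightarrow> (\<Sum>k<n. \<bar>f (r k) - f (l k)\<bar>) < e"
    using f[unfolded abs_continuous_on_def, rule_format, OF \<open>e > 0\<close>] by blast
  show thesis
  proof (rule that[OF \<open>d > 0\<close>])
    fix D assume D: "D tagged_partial_division_of {a..b}" and small: "(\<Sum>(x,K)\<in>D. content K) < d"
    have fin: "finite D" using D by (rule tagged_partial_division_ofD(1))
    define n where "n = card D"
    obtain h where h: "bij_betw h {..<n} D"
      using ex_bij_betw_nat_finite[OF fin] by (auto simp: n_def atLeast0LessThan)
    define l where "l k = Inf (snd (h k))" for k
    define r where "r k = Sup (snd (h k))" for k
    have mem: "h k \<in> D" if "k < n" for k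
      using h that by (auto simp: bij_betw_def)
    have K: "snd (h k) = {l k..r k} \<and> l k \<le> r k \<and> {l k..r k} \<subseteq> {a..b}" if "k < n" for k
    proof -
      obtain x K where hk: "h k = (x, K)" by (cases "h k")
      then have xK: "(x, K) \<in> D" using mem[OF that] by simp
      then obtain u v where "K = cbox u v"
        using tagged_partial_division_ofD(4)[OF D] by blast
      moreover have "x \<in> K" "K \<subseteq> {a..b}"
        using tagged_partial_division_ofD(2,3)[OF D xK] by auto
      ultimately show ?thesis
        by (auto simp: l_def r_def hk)
    qed
    have disj: "disjoint_family_on (\<lambda>k. {l k<..<r k}) {..<n}"
      unfolding disjoint_family_on_def
    proof (intro ballI impI)
      fix j k assume jk: "j \<in> {..<n}" "k \<in> {..<n}" "j \<noteq> k"
      then have "h j \<noteq> h k"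
        using h by (auto simp: bij_betw_def inj_on_def)
      then have "interior (snd (h j)) \<inter> interior (snd (h k)) = {}"
        using tagged_partial_division_ofD(5)[OF D, of "fst (h j)" "snd (h j)" "fst (h k)" "snd (h k)"]
          mem[of j] mem[of k] jk by (auto simp: prod_eq_iff)
      then show "{l j<..<r j} \<inter> {l k<..<r k} = {}"
        using K[of j] K[of k] jk by simp
    qed
    have "(\<Sum>k<n. r k - l k) = (\<Sum>k<n. content (snd (h k)))"
      using K by (intro sum.cong) auto
    also have "\<dots> = (\<Sum>(x,K)\<in>D. content K)"
      using sum.reindex_bij_betw[OF h, of "\<lambda>z. content (snd z)"] by (simp add: case_prod_beta')
    finally have "(\<Sum>k<n. \<bar>f (r k) - f (l k)\<bar>) < e"
      using small K disj by (intro d) auto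
    also have "(\<Sum>k<n. \<bar>f (r k) - f (l k)\<bar>) = (\<Sum>(x,K)\<in>D. \<bar>f (Sup K) - f (Inf K)\<bar>)"
      using sum.reindex_bij_betw[OF h, of "\<lambda>z. \<bar>f (Sup (snd z)) - f (Inf (snd z))\<bar>"]
      by (simp add: case_prod_beta' l_def r_def)
    finally show "(\<Sum>(x,K)\<in>D. \<bar>f (Sup K) - f (Inf K)\<bar>) < e" .
  qed
qed

lemma sum_content_tagged_le_measure:
  fixes D :: "('a::euclidean_space \<times> 'a set) set"
  assumes D: "D tagged_partial_division_of S"
    and sub: "\<And>x K. (x, K) \<in> D \<Longrightarrow> K \<subseteq> U" and U: "U \<in> lmeasurable"
  shows "(\<Sum>(x,K)\<in>D. content K) \<le> measure lebesgue U"
proof -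
  have td: "D tagged_division_of \<Union>(snd ` D)"
    using D by (rule tagged_partial_division_of_Union_self)
  then have div: "snd ` D division_of \<Union>(snd ` D)"
    by (rule division_of_tagged_division)
  have "(\<Sum>(x,K)\<in>D. content K) = sum content (snd ` D)"
    using td by (rule sum.over_tagged_division_lemma) (simp add: content_eq_0_interior)
  also have "\<dots> = measure lebesgue (\<Union>(snd ` D))"
    unfolding content_division[OF div, symmetric]
    using division_ofD(4)[OF div] by (intro sum.cong refl) (metis measure_completion sets_lborel borel_closed closed_cbox)
  also have "\<dots> \<le> measure lebesgue U"
  proof (rule measure_mono_fmeasurable)
    show "\<Union>(snd ` D) \<subseteq> U"
      using sub by fastforce
  qed (use U lmeasurable_division[OF div] in auto)
  finally show ?thesis .
qed

text \<open>
  Fix a gauge-fine tagged division. On the intervals tagged outside \<open>N\<close>, differentiability makes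
  the increment of \<open>f\<close> agree with the Riemann summand up to a multiple of the length. The
  intervals tagged in \<open>N\<close> are forced by the gauge into an open set of small measure, so absolute
  continuity makes the sum of their increments small. With the integrand set to \<open>0\<close> on \<open>N\<close>,
  which does not change the integral, these intervals contribute nothing else.
\<close>

theorem fundamental_theorem_of_calculus_abs_continuous:
  fixes f g :: "real \<Rightarrow> real"
  assumes "a \<le> b" and f: "abs_continuous_on {a..b} f" and N: "negligible N"
    and deriv: "\<And>x. x \<in> {a..b} - N \<Longrightarrow> (f has_real_derivative g x) (at x within {a..b})"
  shows "(g has_integral (f b - f a)) {a..b}"
proof -
  define g0 where "g0 x = (if x \<in> N then 0 else g x)" for x
  have "(g0 has_integral (f b - f a)) (cbox a b)"
    unfolding has_integral
  proof (intro allI impI)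
    fix e :: real assume "e > 0"
    define c where "c = e / (2 * (b - a + 1))"
    have "c > 0" and c: "c * (b - a) < e / 2"
      using \<open>e > 0\<close> \<open>a \<le> b\<close> by (auto simp: c_def field_simps)
    obtain d where "d > 0" and d: "\<And>D. D tagged_partial_division_of {a..b} \<Longrightarrow>
         (\<Sum>(x,K)\<in>D. content K) < d \<Longrightarrow> (\<Sum>(x,K)\<in>D. \<bar>f (Sup K) - f (Inf K)\<bar>) < e / 2"
      using abs_continuous_on_tagged_partial_division[OF f, of "e / 2"] \<open>e > 0\<close> by auto
    have N0: "N \<in> null_sets lebesgue"
      using N by (simp add: negligible_iff_null_sets)
    obtain U where "open U" "N \<subseteq> U" and UN: "U - N \<in> lmeasurable" "emeasure lebesgue (U - N) < d"
      using sets_lebesgue_outer_open[of N d] N0 \<open>d > 0\<close> by auto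
    have eU: "emeasure lebesgue U = emeasure lebesgue (U - N)"
      using emeasure_Un_null_set[OF _ N0, of "U - N"] UN(1) \<open>N \<subseteq> U\<close> by (simp add: Un_absorb2)
    have lt: "emeasure lebesgue U < ennreal d"
      using UN(2) by (simp only: eU)
    have Ulm: "U \<in> lmeasurable"
      using \<open>open U\<close> order_less_trans[OF lt ennreal_less_top] by (intro fmeasurableI) auto
    have "measure lebesgue U < d"
      using lt by (simp only: emeasure_eq_measure2[OF Ulm] ennreal_less_iff[OF measure_nonneg])
    with \<open>open U\<close> \<open>N \<subseteq> U\<close> Ulm have U: "open U" "N \<subseteq> U" "U \<in> lmeasurable" "measure lebesgue U < d"
      by auto
    have "\<exists>r>0. x \<in> {a..b} - N \<longrightarrow>
        (\<forall>y\<in>{a..b}. \<bar>y - x\<bar> < r \<longrightarrow> \<bar>f y - f x - g x * (y - x)\<bar> \<le> c * \<bar>y - x\<bar>)" for x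
    proof (cases "x \<in> {a..b} - N")
      case True
      then show ?thesis
        using deriv[OF True] \<open>c > 0\<close>
        unfolding has_field_derivative_def has_derivative_within_alt by auto
    qed (auto intro: exI[of _ 1])
    then obtain r where r: "\<And>x. r x > 0" "\<And>x y. x \<in> {a..b} - N \<Longrightarrow> y \<in> {a..b} \<Longrightarrow>
        \<bar>y - x\<bar> < r x \<Longrightarrow> \<bar>f y - f x - g x * (y - x)\<bar> \<le> c * \<bar>y - x\<bar>"
      by metis
    \<comment> \<open>The set \<open>U\<close> is itself an open neighbourhood of each of its points.\<close>
    define \<gamma> where "\<gamma> x = (if x \<in> N then U else ball x (r x))" for x
    have "gauge \<gamma>"
      using U r(1) by (auto simp: gauge_def \<gamma>_def)
    have riemann_sum: "norm ((\<Sum>(x,K)\<in>D. content K *\<^sub>R g0 x) - (f b - f a)) < e"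
      if D: "D tagged_division_of cbox a b" and fine: "\<gamma> fine D" for D
    proof -
      have fin: "finite D" using D by (rule tagged_division_ofD(1))
      have fineD: "K \<subseteq> \<gamma> x" if "(x, K) \<in> D" for x K
        using fine that unfolding fine_def by blast
      have part: "D tagged_partial_division_of {a..b}"
        using tagged_division_of_def[of D] D by simp
      define D1 where "D1 = {z \<in> D. fst z \<in> N}"
      define D2 where "D2 = {z \<in> D. fst z \<notin> N}"
      have D12: "D1 \<subseteq> D" "D2 \<subseteq> D" "D1 \<inter> D2 = {}" "D = D1 \<union> D2" "finite D1" "finite D2"
        using fin by (auto simp: D1_def D2_def)
      let ?E = "\<lambda>(x,K). content K * g0 x - (f (Sup K) - f (Inf K))"
      have "(\<Sum>(x,K)\<in>D. content K *\<^sub>R g0 x) - (f b - f a) = (\<Sum>z\<in>D. ?E z)"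
        using additive_tagged_division_1[OF \<open>a \<le> b\<close>, of D f] D
        by (simp add: sum_subtractf case_prod_beta')
      also have "\<dots> = (\<Sum>z\<in>D1. ?E z) + (\<Sum>z\<in>D2. ?E z)"
        using D12 by (simp add: sum.union_disjoint)
      finally have split: "(\<Sum>(x,K)\<in>D. content K *\<^sub>R g0 x) - (f b - f a)
          = (\<Sum>z\<in>D1. ?E z) + (\<Sum>z\<in>D2. ?E z)" .
      have part1: "D1 tagged_partial_division_of {a..b}"
        using part D12(1) by (rule tagged_partial_division_subset)
      have "(\<Sum>(x,K)\<in>D1. content K) \<le> measure lebesgue U"
        using fineD by (intro sum_content_tagged_le_measure[OF part1 _ U(3)])
          (force simp: D1_def \<gamma>_def)
      then have "(\<Sum>(x,K)\<in>D1. \<bar>f (Sup K) - f (Inf K)\<bar>) < e / 2"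
        using U(4) by (intro d part1) simp
      moreover have "\<bar>\<Sum>z\<in>D1. ?E z\<bar> \<le> (\<Sum>(x,K)\<in>D1. \<bar>f (Sup K) - f (Inf K)\<bar>)"
        by (rule order_trans[OF sum_abs]) (auto intro!: sum_mono simp: D1_def g0_def)
      moreover have "\<bar>\<Sum>z\<in>D2. ?E z\<bar> \<le> c * (b - a)"
      proof -
        have "\<bar>?E z\<bar> \<le> (case z of (x,K) \<Rightarrow> c * content K)" if "z \<in> D2" for z
        proof -
          obtain x K where z: "z = (x, K)" by (cases z)
          with that have xK: "(x, K) \<in> D" "x \<notin> N" by (auto simp: D2_def)
          obtain u v where K: "K = {u..v}"
            using tagged_partial_division_ofD(4)[OF part xK(1)] by auto
          have x: "x \<in> K" "K \<subseteq> {a..b}"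
            using tagged_partial_division_ofD(2,3)[OF part xK(1)] by auto
          have "u \<in> K" "v \<in> K" and uv: "u \<le> x" "x \<le> v"
            using x(1) by (auto simp: K)
          moreover have "K \<subseteq> ball x (r x)"
            using fineD[OF xK(1)] xK(2) by (simp add: \<gamma>_def)
          ultimately have uv_mem: "u \<in> ball x (r x)" "v \<in> ball x (r x)" "u \<in> {a..b}" "v \<in> {a..b}"
            using x(2) by blast+
          have "x \<in> {a..b} - N"
            using x xK(2) by blast
          then have "\<bar>f u - f x - g x * (u - x)\<bar> \<le> c * \<bar>u - x\<bar>"
                    "\<bar>f v - f x - g x * (v - x)\<bar> \<le> c * \<bar>v - x\<bar>"
            using uv_mem by (auto intro!: r(2) simp: dist_real_def)
          then have "\<bar>f u - f x - g x * (u - x)\<bar> + \<bar>f v - f x - g x * (v - x)\<bar> \<le> c * (v - u)"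
            using uv by (simp add: algebra_simps)
          then show ?thesis
            using uv xK(2) by (simp add: z K g0_def algebra_simps)
        qed
        then have "\<bar>\<Sum>z\<in>D2. ?E z\<bar> \<le> (\<Sum>(x,K)\<in>D2. c * content K)"
          by (intro order_trans[OF sum_abs] sum_mono)
        also have "\<dots> \<le> (\<Sum>(x,K)\<in>D. c * content K)"
          using D12(2) fin \<open>c > 0\<close> by (intro sum_mono2) auto
        also have "\<dots> = c * (b - a)"
        proof -
          have "(\<Sum>(x,K)\<in>D. c * content K) = c * (\<Sum>(x,K)\<in>D. content K)"
            by (simp only: sum_distrib_left case_prod_unfold)
          then show ?thesis
            using additive_content_tagged_division[OF D] \<open>a \<le> b\<close> by simp
        qed
        finally show ?thesis .
      qed
      ultimately show ?thesis
        using c by (simp only: split real_norm_def)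
    qed
    show "\<exists>\<gamma>. gauge \<gamma> \<and> (\<forall>D. D tagged_division_of cbox a b \<and> \<gamma> fine D \<longrightarrow>
        norm ((\<Sum>(x,K)\<in>D. content K *\<^sub>R g0 x) - (f b - f a)) < e)"
      using \<open>gauge \<gamma>\<close> riemann_sum by (intro exI[of _ \<gamma>] conjI allI impI) (simp_all only:)
  qed
  then show ?thesis
    using has_integral_spike[OF N, of "{a..b}" g g0] by (simp add: g0_def)
qed

section \<open>Barbalat's lemma\<close>

text \<open>
  By the mean value theorem the difference quotient of \<open>F\<close> with a fixed small step \<open>h\<close>, which
  tends to \<open>0\<close>, is a value of \<open>g\<close> at a point within distance \<open>h\<close>; uniform continuity
  transfers the smallness to \<open>g t\<close>.
\<close>

lemma barbalat:
  fixes F g :: "real \<Rightarrow> real"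
  assumes deriv: "\<And>t. t \<ge> 0 \<Longrightarrow> (F has_real_derivative g t) (at t within {0..})"
    and uc: "uniformly_continuous_on {0..} g"
    and lim: "(F \<longlongrightarrow> L) at_top"
  shows "(g \<longlongrightarrow> 0) at_top"
proof (rule tendstoI)
  fix e :: real assume "e > 0"
  obtain d where "d > 0" and d: "\<And>s t. s \<ge> 0 \<Longrightarrow> t \<ge> 0 \<Longrightarrow> \<bar>s - t\<bar> < d \<Longrightarrow> \<bar>g s - g t\<bar> < e / 2"
    using uc \<open>e > 0\<close> unfolding uniformly_continuous_on_def dist_real_def
    by (metis atLeast_iff half_gt_zero)
  define h where "h = d / 2"
  have h: "h > 0" "h < d" using \<open>d > 0\<close> by (auto simp: h_def)
  have "filterlim (\<lambda>t. t + h) at_top at_top"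
    by (rule filterlim_at_top_mono[OF filterlim_ident]) (use h in auto)
  then have "((\<lambda>t. F (t + h)) \<longlongrightarrow> L) at_top"
    by (rule filterlim_compose[OF lim])
  then have "((\<lambda>t. (F (t + h) - F t) / h) \<longlongrightarrow> (L - L) / h) at_top"
    using lim h by (intro tendsto_intros) auto
  then have "((\<lambda>t. (F (t + h) - F t) / h) \<longlongrightarrow> 0) at_top"
    by simp
  then have "\<forall>\<^sub>F t in at_top. \<bar>(F (t + h) - F t) / h\<bar> < e / 2"
    using \<open>e > 0\<close> by (auto dest!: tendstoD[where e = "e / 2"] simp: dist_real_def)
  moreover have "\<forall>\<^sub>F t in at_top. (t::real) \<ge> 0"
    by (rule eventually_ge_at_top)
  ultimately show "\<forall>\<^sub>F t in at_top. dist (g t) 0 < e"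
  proof eventually_elim
    case (elim t)
    have "(F has_derivative (*) (g x)) (at x within {t..t + h})" if "t \<le> x" for x
      using deriv[of x] that elim(2)
      by (auto simp: has_field_derivative_def intro: has_derivative_subset)
    then obtain x where x: "x \<in> {t..t + h}" "F (t + h) - F t = g x * (t + h - t)"
      using mvt_very_simple[of t "t + h" F "\<lambda>x. (*) (g x)"] h by auto
    then have "\<bar>g x\<bar> < e / 2"
      using elim(1) h by simp
    moreover have "\<bar>g t - g x\<bar> < e / 2"
      using x(1) elim(2) h by (intro d) auto
    ultimately show ?case
      unfolding dist_real_def by linarith
  qed
qed

lemma mono_bounded_convergent_at_top:
  fixes F :: "real \<Rightarrow> real"
  assumes mono: "mono_on {0..} F" and bound: "\<And>t. t \<ge> 0 \<Longrightarrow> F t \<le> B"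
  obtains L where "(F \<longlongrightarrow> L) at_top"
proof
  define L where "L = (SUP t\<in>{0..}. F t)"
  have bdd: "bdd_above (F ` {0..})"
    using bound by (intro bdd_aboveI2) auto
  show "(F \<longlongrightarrow> L) at_top"
  proof (rule order_tendstoI)
    fix a assume "a < L"
    then obtain s where s: "s \<ge> 0" "a < F s"
      unfolding L_def using less_cSUP_iff[OF _ bdd, of a] by auto
    show "\<forall>\<^sub>F t in at_top. a < F t"
      using eventually_ge_at_top[of s]
    proof eventually_elim
      case (elim t)
      then have "F s \<le> F t" using mono s by (intro mono_onD[OF mono]) auto
      with s show ?case by linarith
    qed
  next
    fix a assume "L < a"
    show "\<forall>\<^sub>F t in at_top. F t < a"
      using eventually_ge_at_top[of 0]
    proof eventually_elim
      case (elim t)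
      then have "F t \<le> L" unfolding L_def using bdd by (intro cSUP_upper) auto
      with \<open>L < a\<close> show ?case by linarith
    qed
  qed
qed

section \<open>Dissipation of the smoothed distance to the equilibrium\<close>

text \<open>
  The derivative \<open>x / sqrt (x\<^sup>2 + e\<^sup>2)\<close> of the smoothed absolute value replaces the sign of \<open>x\<close>. It
  is far from \<open>\<plusminus>1\<close> only where \<open>x\<close>, and hence \<open>y\<close>, is at most of the order of \<open>e\<close>, so that
  the error is of that order as well.
\<close>

lemma smoothed_sign_mult_ge:
  fixes x y e :: real
  assumes "e > 0" and same_sign: "x * y \<ge> 0" and "\<bar>y\<bar> \<le> K * \<bar>x\<bar>" and "K \<ge> 0"
  shows "\<bar>y\<bar> - K * e \<le> x / sqrt (x\<^sup>2 + e\<^sup>2) * y"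
proof -
  define r where "r = sqrt (x\<^sup>2 + e\<^sup>2)"
  have "r > 0"
    using \<open>e > 0\<close> by (auto simp: r_def intro!: add_nonneg_pos)
  have "\<bar>x\<bar> \<le> r"
    unfolding r_def by (rule real_le_rsqrt) simp
  have "r \<le> \<bar>x\<bar> + e"
    using sqrt_sum_squares_le_sum_abs[of x e] \<open>e > 0\<close> by (simp add: r_def)
  have "\<bar>y\<bar> * (r - \<bar>x\<bar>) \<le> K * \<bar>x\<bar> * (r - \<bar>x\<bar>)"
    using assms(3) \<open>\<bar>x\<bar> \<le> r\<close> by (intro mult_right_mono) auto
  also have "\<dots> \<le> K * r * e"
    using \<open>\<bar>x\<bar> \<le> r\<close> \<open>r \<le> \<bar>x\<bar> + e\<close> \<open>K \<ge> 0\<close> \<open>r > 0\<close> by (intro mult_mono) auto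
  finally have "\<bar>y\<bar> * r - K * e * r \<le> \<bar>x\<bar> * \<bar>y\<bar>"
    by (simp add: algebra_simps)
  also have "\<bar>x\<bar> * \<bar>y\<bar> = x * y"
    using same_sign by (simp flip: abs_mult)
  finally have "(\<bar>y\<bar> - K * e) * r \<le> x * y"
    by (simp add: algebra_simps)
  then have "\<bar>y\<bar> - K * e \<le> x * y / r"
    using \<open>r > 0\<close> by (simp add: pos_le_divide_eq)
  then show ?thesis
    by (simp add: r_def)
qed

lemma abs_smoothed_sign_le_1: "\<bar>x / sqrt (x\<^sup>2 + e\<^sup>2)\<bar> \<le> (1::real)"
proof -
  define r where "r = sqrt (x\<^sup>2 + e\<^sup>2)"
  have "r \<ge> 0" "\<bar>x\<bar> \<le> r"
    unfolding r_def by (auto intro: real_le_rsqrt)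
  then have "\<bar>x\<bar> / r \<le> r / r"
    by (intro divide_right_mono)
  also have "\<dots> \<le> 1" by simp
  finally show ?thesis
    using \<open>r \<ge> 0\<close> by (simp add: r_def[symmetric])
qed

text \<open>
  The differential inequality for the truncated \<open>\<ell>\<^sub>1\<close> distance: \<open>x\<close> and \<open>y\<close> are the deviations of a
  state and of its image under \<open>f\<close>, and the factor after the smoothed sign is the time
  derivative of the deviation. Each flux appears once as an inflow, where the smoothed sign is
  bounded by \<open>1\<close>, and once as an outflow, where the smoothed sign nearly restores its absolute
  value. Hence the sum telescopes up to an error of \<open>(K + 1) * e\<close> per level.
\<close>

lemma smoothed_l1_dissipation:
  fixes x y :: "nat \<Rightarrow> real"
  assumes "0 \<le> lam" "lam \<le> 1" "e > 0" "K \<ge> 0" and y0: "y 0 = 0"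
    and same_sign: "\<And>i. x i * y i \<ge> 0" and lip: "\<And>i. \<bar>y i\<bar> \<le> K * \<bar>x i\<bar>"
  shows "(\<Sum>i=1..n. x i / sqrt ((x i)\<^sup>2 + e\<^sup>2) * (lam * (y (i - 1) - y i) - (x i - x (i + 1))))
       \<le> \<bar>x (n + 1)\<bar> - \<bar>x 1\<bar> + real n * ((K + 1) * e)"
proof -
  define s where "s i = x i / sqrt ((x i)\<^sup>2 + e\<^sup>2)" for i
  have flux: "s i * z \<le> \<bar>z\<bar>" for i z
  proof -
    have "s i * z \<le> \<bar>s i\<bar> * \<bar>z\<bar>" by (simp flip: abs_mult)
    also have "\<dots> \<le> 1 * \<bar>z\<bar>"
      unfolding s_def by (intro mult_right_mono abs_smoothed_sign_le_1) auto
    finally show ?thesis by simp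
  qed
  \<comment> \<open>The boundary term \<open>lam * \<bar>y n\<bar>\<close> is kept to make the induction go through.\<close>
  have "(\<Sum>i=1..n. s i * (lam * (y (i - 1) - y i) - (x i - x (i + 1))))
       \<le> \<bar>x (n + 1)\<bar> - \<bar>x 1\<bar> - lam * \<bar>y n\<bar> + real n * ((K + 1) * e)"
  proof (induction n)
    case (Suc n)
    have "\<bar>y (Suc n)\<bar> - K * e \<le> s (Suc n) * y (Suc n)"
      unfolding s_def using assms by (intro smoothed_sign_mult_ge) auto
    then have "lam * (\<bar>y (Suc n)\<bar> - K * e) \<le> lam * (s (Suc n) * y (Suc n))"
      using \<open>0 \<le> lam\<close> by (rule mult_left_mono)
    moreover have "lam * (K * e) \<le> K * e"
      using assms by (intro mult_left_le_one_le) auto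
    moreover have "\<bar>x (Suc n)\<bar> - 1 * e \<le> s (Suc n) * x (Suc n)"
      unfolding s_def using assms by (intro smoothed_sign_mult_ge) auto
    moreover have "lam * (s (Suc n) * y n) \<le> lam * \<bar>y n\<bar>"
      using flux \<open>0 \<le> lam\<close> by (intro mult_left_mono) auto
    moreover have "s (Suc n) * x (Suc (Suc n)) \<le> \<bar>x (Suc (Suc n))\<bar>"
      by (rule flux)
    ultimately have "s (Suc n) * (lam * (y n - y (Suc n)) - (x (Suc n) - x (Suc (Suc n))))
        \<le> lam * \<bar>y n\<bar> - lam * \<bar>y (Suc n)\<bar> - \<bar>x (Suc n)\<bar> + \<bar>x (Suc (Suc n))\<bar> + (K + 1) * e"
      by (simp add: algebra_simps)
    with Suc show ?case
      by (simp add: algebra_simps)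
  qed (simp add: y0)
  moreover have "lam * \<bar>y n\<bar> \<ge> 0" using \<open>0 \<le> lam\<close> by simp
  ultimately show ?thesis
    by (simp add: s_def)
qed

section \<open>The rate function and the equilibrium\<close>

locale fluid_model =
  fixes lam :: real and p :: "nat \<Rightarrow> real" and q :: "real \<Rightarrow> nat \<Rightarrow> real"
  assumes lam: "0 < lam" "lam < 1"
    and p_nonneg: "\<And>d. 0 \<le> p d" and p_sums: "p sums 1"
    and p_mean: "summable (\<lambda>d. real d * p d)"
    and trajectory: "fluid_trajectory lam (gen_fun p) q"
begin

definition f :: "real \<Rightarrow> real" where
  "f x = x * gen_fun p x"

text \<open>
  This is the left derivative of \<open>f\<close> at \<open>1\<close>, and so the best Lipschitz constant of the convex
  function \<open>f\<close> on the unit interval.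
\<close>

definition K :: real where
  "K = (\<Sum>d. real (Suc d) * p d)"

lemma summable_K: "summable (\<lambda>d. real (Suc d) * p d)"
  using summable_add[OF p_mean sums_summable[OF p_sums]] by (simp add: algebra_simps)

lemma K_nonneg: "K \<ge> 0"
  unfolding K_def using summable_K p_nonneg by (intro suminf_nonneg) auto

lemma f_sums:
  assumes "x \<in> {0..1}"
  shows "(\<lambda>d. x ^ Suc d * p d) sums f x"
proof -
  have "summable (\<lambda>d. x ^ d * p d)"
  proof (rule summable_comparison_test'[OF sums_summable[OF p_sums], of 0])
    fix d show "norm (x ^ d * p d) \<le> p d"
      using assms p_nonneg[of d] by (auto simp: abs_mult power_le_one mult_left_le_one_le)
  qed
  then have "(\<lambda>d. x ^ d * p d) sums gen_fun p x"
    unfolding gen_fun_def by (rule summable_sums)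
  then show ?thesis
    unfolding f_def using sums_mult[of "\<lambda>d. x ^ d * p d" _ x] by (simp add: mult.assoc)
qed

lemma f_mono:
  assumes "0 \<le> x" "x \<le> y" "y \<le> 1"
  shows "f x \<le> f y"
proof (rule sums_le)
  show "x ^ Suc d * p d \<le> y ^ Suc d * p d" for d
    using assms p_nonneg by (intro mult_right_mono power_mono) auto
  show "(\<lambda>d. x ^ Suc d * p d) sums f x" "(\<lambda>d. y ^ Suc d * p d) sums f y"
    using assms by (intro f_sums; simp)+
qed

lemma f_bounds:
  assumes "x \<in> {0..1}"
  shows "0 \<le> f x" "f x \<le> x"
proof -
  show "0 \<le> f x"
    by (rule sums_le[OF _ sums_zero f_sums[OF assms]]) (use assms p_nonneg in auto)
  show "f x \<le> x"
  proof (rule sums_le[OF _ f_sums[OF assms]])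
    show "(\<lambda>d. x * p d) sums x"
      using sums_mult[OF p_sums, of x] by simp
    show "x ^ Suc d * p d \<le> x * p d" for d
      using assms p_nonneg[of d] by (intro mult_right_mono) (auto simp: power_le_one mult_left_le)
  qed
qed

lemma f_1: "f 1 = 1"
  using p_sums sums_unique2[OF f_sums[of 1]] by simp

lemma f_lipschitz:
  assumes "x \<in> {0..1}" "y \<in> {0..1}"
  shows "\<bar>f x - f y\<bar> \<le> K * \<bar>x - y\<bar>"
proof -
  have sums: "(\<lambda>d. x ^ Suc d * p d - y ^ Suc d * p d) sums (f x - f y)"
    using assms by (intro sums_diff f_sums)
  have "norm (\<Sum>d. x ^ Suc d * p d - y ^ Suc d * p d) \<le> (\<Sum>d. real (Suc d) * p d * \<bar>x - y\<bar>)"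
  proof (rule norm_suminf_le)
    fix d
    have "norm (x ^ Suc d - y ^ Suc d) \<le> real (Suc d) * norm (x - y)"
      using assms by (intro norm_power_diff) auto
    then have "\<bar>x ^ Suc d - y ^ Suc d\<bar> * p d \<le> real (Suc d) * \<bar>x - y\<bar> * p d"
      using p_nonneg by (intro mult_right_mono) (simp_all only: real_norm_def)
    moreover have "norm (x ^ Suc d * p d - y ^ Suc d * p d) = \<bar>x ^ Suc d - y ^ Suc d\<bar> * p d"
      using p_nonneg[of d] by (simp only: left_diff_distrib[symmetric] real_norm_def abs_mult abs_of_nonneg)
    ultimately show "norm (x ^ Suc d * p d - y ^ Suc d * p d) \<le> real (Suc d) * p d * \<bar>x - y\<bar>"
      by (simp only: mult_ac)
  qed (intro summable_mult2 summable_K)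
  also have "(\<Sum>d. x ^ Suc d * p d - y ^ Suc d * p d) = f x - f y"
    using sums by (rule sums_unique[symmetric])
  also have "(\<Sum>d. real (Suc d) * p d * \<bar>x - y\<bar>) = K * \<bar>x - y\<bar>"
    unfolding K_def by (rule suminf_mult2[OF summable_K, symmetric])
  finally show ?thesis by simp
qed

abbreviation qs :: "nat \<Rightarrow> real" where
  "qs \<equiv> q_star lam (gen_fun p)"

text \<open>
  As \<open>f 1 = 1\<close>, the value \<open>q\<^sup>*(1) = \<lambda>\<close> fits the recursion, which makes \<open>q\<^sup>*\<close> stationary at
  level \<open>1\<close> too.
\<close>

lemma q_star_Suc: "qs (Suc i) = lam * f (qs i)"
  using f_1 by (cases i) (auto simp: f_def)

text \<open>
  Since \<open>f x \<le> x\<close>, the equilibrium decays geometrically; in particular it is in \<open>\<ell>\<^sub>1\<close>.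
\<close>

lemma q_star_bounds: "0 \<le> qs i \<and> qs i \<le> lam ^ i"
proof (induction i)
  case (Suc i)
  have "qs i \<in> {0..1}"
    using Suc power_le_one[of lam i] lam by auto
  then have "0 \<le> f (qs i)" "f (qs i) \<le> lam ^ i"
    using f_bounds[of "qs i"] Suc by auto
  then show ?case
    using lam by (simp only: q_star_Suc) (auto intro: mult_left_mono)
qed simp

lemma q_star_mem: "qs i \<in> {0..1}"
  using q_star_bounds[of i] power_le_one[of lam i] lam by auto

lemma q_star_summable: "summable qs"
  by (rule summable_comparison_test'[OF summable_geometric[of lam], of 0])
     (use q_star_bounds lam in auto)

section \<open>Regularity of the deviation from the equilibrium\<close>

lemma q_0: "q t 0 = 1" if "t \<ge> 0"
  using trajectory that unfolding fluid_trajectory_def occupancy_space_def by auto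

lemma q_mem: "q t i \<in> {0..1}" if "t \<ge> 0"
proof -
  have *: "0 \<le> q t (Suc j)" "q t (Suc j) \<le> q t j" "q t j \<le> 1" if "j \<ge> 1" for j
    using trajectory \<open>t \<ge> 0\<close> that q_0[OF \<open>t \<ge> 0\<close>]
    unfolding fluid_trajectory_def occupancy_space_def by force+
  show ?thesis
    using *[of i] q_0[OF that] by (cases "i = 0") auto
qed

lemma q_summable: "summable (q t)" if "t \<ge> 0"
  using trajectory that unfolding fluid_trajectory_def occupancy_space_def
  by (auto intro: summable_rabs_cancel)

definition dev :: "nat \<Rightarrow> real \<Rightarrow> real" where
  "dev i t = q t i - qs i"

definition fdev :: "nat \<Rightarrow> real \<Rightarrow> real" where
  "fdev i t = f (q t i) - f (qs i)"

definition rate :: "nat \<Rightarrow> real \<Rightarrow> real" where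
  "rate i t = lam * (fdev (i - 1) t - fdev i t) - (dev i t - dev (i + 1) t)"

text \<open>
  The equilibrium terms cancel, so \<open>rate\<close> is the right-hand side of the fluid equation.
\<close>

lemma rate_eq:
  assumes "i \<ge> 1"
  shows "rate i t = lam * (f (q t (i - 1)) - f (q t i)) - (q t i - q t (i + 1))"
proof -
  obtain j where i: "i = Suc j" using assms by (cases i) auto
  have "lam * (f (qs j) - f (qs (Suc j))) = qs (Suc j) - qs (Suc (Suc j))"
    by (simp add: q_star_Suc algebra_simps del: q_star.simps)
  then show ?thesis
    by (simp add: i rate_def dev_def fdev_def algebra_simps del: q_star.simps)
qed

lemma dev_0: "dev 0 t = 0" if "t \<ge> 0"
  using q_0[OF that] by (simp add: dev_def)

lemma dev_bound: "\<bar>dev i t\<bar> \<le> 1" if "t \<ge> 0"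
  using q_mem[OF that, of i] q_star_mem[of i] by (auto simp: dev_def)

lemma dev_summable: "summable (\<lambda>i. \<bar>dev i t\<bar>)" if "t \<ge> 0"
proof (rule summable_comparison_test'[OF summable_add[OF q_summable[OF that] q_star_summable], of 0])
  show "norm \<bar>dev i t\<bar> \<le> q t i + qs i" for i
    using q_mem[OF that, of i] q_star_mem[of i] by (auto simp: dev_def)
qed

lemma fdev_lipschitz: "\<bar>fdev i t\<bar> \<le> K * \<bar>dev i t\<bar>" if "t \<ge> 0"
  unfolding fdev_def dev_def using q_mem[OF that] q_star_mem by (rule f_lipschitz)

lemma fdev_same_sign: "dev i t * fdev i t \<ge> 0" if "t \<ge> 0"
  using f_mono[of "q t i" "qs i"] f_mono[of "qs i" "q t i"] q_mem[OF that, of i] q_star_mem[of i]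
  by (cases "q t i \<le> qs i")
    (auto simp: dev_def fdev_def intro: mult_nonneg_nonneg mult_nonpos_nonpos)

lemma rate_bound: "\<bar>rate i t\<bar> \<le> 2" if "t \<ge> 0" "i \<ge> 1"
proof -
  have b: "0 \<le> f (q t j) \<and> f (q t j) \<le> 1" for j
    using f_bounds[OF q_mem[OF \<open>t \<ge> 0\<close>, of j]] q_mem[OF \<open>t \<ge> 0\<close>, of j] by auto
  have "\<bar>lam * (f (q t (i - 1)) - f (q t i))\<bar> \<le> 1 * 1"
    unfolding abs_mult using b[of i] b[of "i - 1"] lam by (intro mult_mono) auto
  moreover have "\<bar>q t i - q t (i + 1)\<bar> \<le> 1"
    using q_mem[OF \<open>t \<ge> 0\<close>, of i] q_mem[OF \<open>t \<ge> 0\<close>, of "i + 1"] by auto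
  ultimately show ?thesis
    unfolding rate_eq[OF \<open>i \<ge> 1\<close>] by linarith
qed

text \<open>
  The almost everywhere differential equation in integrated form. It comes before any continuity
  of \<open>rate\<close>: the boundedness of \<open>rate\<close> then makes \<open>dev\<close>, and in turn \<open>rate\<close>, Lipschitz in time.
\<close>

lemma rate_has_integral:
  assumes "i \<ge> 1" "0 \<le> a" "a \<le> b"
  shows "(rate i has_integral dev i b - dev i a) {a..b}"
proof -
  have "AE t in lebesgue. t \<ge> 0 \<longrightarrow> ((\<lambda>s. q s i) has_real_derivative rate i t) (at t within {0..})"
    using trajectory \<open>i \<ge> 1\<close> unfolding fluid_trajectory_def rate_eq[OF \<open>i \<ge> 1\<close>] f_def by blast
  then obtain N where "N \<in> null_sets lebesgue"
    and N: "\<And>t. t \<notin> N \<Longrightarrow> t \<ge> 0 \<Longrightarrow> ((\<lambda>s. q s i) has_real_derivative rate i t) (at t within {0..})"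
    by (auto elim!: AE_E3)
  moreover have "abs_continuous_on {a..b} (\<lambda>t. q t i)"
    using trajectory assms unfolding fluid_trajectory_def by blast
  ultimately have "(rate i has_integral q b i - q a i) {a..b}"
    using assms
    by (intro fundamental_theorem_of_calculus_abs_continuous[where N = N])
       (auto simp: negligible_iff_null_sets intro: DERIV_subset[OF N])
  then show ?thesis by (simp add: dev_def)
qed

lemma dev_lipschitz: "\<bar>dev i s - dev i t\<bar> \<le> 2 * \<bar>s - t\<bar>" if "s \<ge> 0" "t \<ge> 0"
proof (cases "i = 0")
  case False
  have "\<bar>dev i b - dev i a\<bar> \<le> 2 * (b - a)" if "0 \<le> a" "a \<le> b" for a b
    using has_integral_bound[of 2 "rate i" "dev i b - dev i a" a b] rate_has_integral[of i a b]
      rate_bound[of _ i] False that by auto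
  from this[of s t] this[of t s] show ?thesis
    using that by (cases "s \<le> t") (auto simp: abs_minus_commute)
qed (simp add: dev_0 that)

lemma rate_uniformly_continuous: "uniformly_continuous_on {0..} (rate i)"
proof (rule lipschitz_on_uniformly_continuous)
  show "(4 * K + 4)-lipschitz_on {0..} (rate i)"
  proof (rule lipschitz_onI)
    fix s t :: real assume "s \<in> {0..}" "t \<in> {0..}"
    then have st: "s \<ge> 0" "t \<ge> 0" by auto
    have fd: "\<bar>fdev j s - fdev j t\<bar> \<le> 2 * K * \<bar>s - t\<bar>" for j
    proof -
      have "\<bar>fdev j s - fdev j t\<bar> \<le> K * \<bar>q s j - q t j\<bar>"
        using f_lipschitz[OF q_mem[OF st(1)] q_mem[OF st(2)]] by (simp add: fdev_def)
      also have "\<dots> = K * \<bar>dev j s - dev j t\<bar>"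
        by (simp add: dev_def)
      also have "\<dots> \<le> K * (2 * \<bar>s - t\<bar>)"
        using dev_lipschitz[OF st] K_nonneg by (intro mult_left_mono) auto
      finally show ?thesis by simp
    qed
    have flux: "\<bar>lam * ((fdev (i - 1) s - fdev (i - 1) t) - (fdev i s - fdev i t))\<bar>
        \<le> 1 * (2 * K * \<bar>s - t\<bar> + 2 * K * \<bar>s - t\<bar>)" (is "\<bar>?A\<bar> \<le> _")
      unfolding abs_mult
    proof (rule mult_mono)
      show "\<bar>fdev (i - 1) s - fdev (i - 1) t - (fdev i s - fdev i t)\<bar>
          \<le> 2 * K * \<bar>s - t\<bar> + 2 * K * \<bar>s - t\<bar>"
        using fd[of "i - 1"] fd[of i] by linarith
    qed (use lam in auto)
    have "rate i s - rate i t = ?A - ((dev i s - dev i t) - (dev (i + 1) s - dev (i + 1) t))"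
      by (simp add: rate_def algebra_simps)
    then have "\<bar>rate i s - rate i t\<bar> \<le> \<bar>?A\<bar> + \<bar>(dev i s - dev i t) - (dev (i + 1) s - dev (i + 1) t)\<bar>"
      by (simp only: abs_triangle_ineq4)
    also have "\<dots> \<le> \<bar>?A\<bar> + (\<bar>dev i s - dev i t\<bar> + \<bar>dev (i + 1) s - dev (i + 1) t\<bar>)"
      by (intro add_left_mono abs_triangle_ineq4)
    also have "\<dots> \<le> 1 * (2 * K * \<bar>s - t\<bar> + 2 * K * \<bar>s - t\<bar>) + (2 * \<bar>s - t\<bar> + 2 * \<bar>s - t\<bar>)"
      by (intro add_mono flux dev_lipschitz st)
    finally have "\<bar>rate i s - rate i t\<bar>
        \<le> 1 * (2 * K * \<bar>s - t\<bar> + 2 * K * \<bar>s - t\<bar>) + (2 * \<bar>s - t\<bar> + 2 * \<bar>s - t\<bar>)" .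
    then show "dist (rate i s) (rate i t) \<le> (4 * K + 4) * dist s t"
      by (simp add: dist_real_def algebra_simps)
  qed (use K_nonneg in auto)
qed

text \<open>
  The integrand being continuous, the integral equation can be differentiated at every time.
\<close>

lemma dev_has_derivative:
  assumes "i \<ge> 1" "t \<ge> 0"
  shows "(dev i has_real_derivative rate i t) (at t within {0..})"
proof -
  have "continuous_on {0..t + 1} (rate i)"
    using uniformly_continuous_imp_continuous[OF rate_uniformly_continuous]
    by (rule continuous_on_subset) auto
  then have "((\<lambda>u. integral {0..u} (rate i)) has_real_derivative rate i t) (at t within {0..t + 1})"
    using \<open>t \<ge> 0\<close> by (intro integral_has_real_derivative) auto
  then have "((\<lambda>u. dev i 0 + integral {0..u} (rate i)) has_real_derivative rate i t) (at t within {0..t + 1})"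
    by (auto intro!: derivative_eq_intros)
  then have "(dev i has_real_derivative rate i t) (at t within {0..t + 1})"
  proof (rule has_field_derivative_transform_within[OF _ zero_less_one])
    show "t \<in> {0..t + 1}" using \<open>t \<ge> 0\<close> by simp
    show "dev i 0 + integral {0..u} (rate i) = dev i u" if "u \<in> {0..t + 1}" for u
      using rate_has_integral[of i 0 u] \<open>i \<ge> 1\<close> that by (simp add: integral_unique)
  qed
  moreover have "at t within {0..t + 1} = at t within {0..}"
    by (rule at_within_nhd[of t "{..<t + 1}"]) auto
  ultimately show ?thesis by simp
qed

lemma dev_continuous: "continuous_on {0..} (dev i)"
proof -
  have "2-lipschitz_on {0..} (dev i)"
    by (rule lipschitz_onI) (auto simp: dist_real_def dev_lipschitz)
  then show ?thesis by (rule lipschitz_on_continuous_on)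
qed

lemma abs_dev_integrable: "(\<lambda>t. \<bar>dev i t\<bar>) integrable_on {a..b}" if "a \<ge> 0"
  by (intro integrable_continuous_interval continuous_intros continuous_on_subset[OF dev_continuous])
     (use that in auto)

section \<open>Convergence to the equilibrium\<close>

text \<open>
  Truncation at level \<open>n\<close> keeps the sum finite, so that it can be differentiated term by term; the
  price is the inflow from level \<open>n + 1\<close>. The bound follows by integrating
  \<open>smoothed_l1_dissipation\<close> over the time interval.
\<close>

lemma truncated_l1_dissipation:
  assumes "T \<ge> 0" "e > 0"
  shows "integral {0..T} (\<lambda>t. \<bar>dev 1 t\<bar>)
    \<le> (\<Sum>i. \<bar>dev i 0\<bar>) + integral {0..T} (\<lambda>t. \<bar>dev (n + 1) t\<bar>) + real n * e * (1 + T * (K + 1))"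
proof -
  define \<Phi> where "\<Phi> t = (\<Sum>i=1..n. sqrt ((dev i t)\<^sup>2 + e\<^sup>2))" for t
  define \<Phi>' where "\<Phi>' t = (\<Sum>i=1..n. dev i t / sqrt ((dev i t)\<^sup>2 + e\<^sup>2) * rate i t)" for t
  define c where "c = real n * ((K + 1) * e)"
  have pos: "0 < (dev i t)\<^sup>2 + e\<^sup>2" for i t
    using \<open>e > 0\<close> by (intro add_nonneg_pos) auto
  have "(\<Phi>' has_integral (\<Phi> T - \<Phi> 0)) {0..T}"
  proof (rule fundamental_theorem_of_calculus[OF \<open>T \<ge> 0\<close>])
    fix t assume t: "t \<in> {0..T}"
    have "((\<lambda>t. sqrt ((dev i t)\<^sup>2 + e\<^sup>2)) has_real_derivative
        dev i t / sqrt ((dev i t)\<^sup>2 + e\<^sup>2) * rate i t) (at t within {0..T})" if "i \<in> {1..n}" for i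
    proof -
      have "(dev i has_real_derivative rate i t) (at t within {0..T})"
        using dev_has_derivative[of i t] that t by (auto intro: DERIV_subset)
      then show ?thesis
        using pos[of i t] by (auto intro!: derivative_eq_intros simp: field_simps)
    qed
    then have "(\<Phi> has_real_derivative \<Phi>' t) (at t within {0..T})"
      unfolding \<Phi>_def[abs_def] \<Phi>'_def by (intro DERIV_sum) auto
    then show "(\<Phi> has_vector_derivative \<Phi>' t) (at t within {0..T})"
      by (simp add: has_real_derivative_iff_has_vector_derivative)
  qed
  moreover have "((\<lambda>t. \<bar>dev (n + 1) t\<bar> - \<bar>dev 1 t\<bar> + c) has_integral
      integral {0..T} (\<lambda>t. \<bar>dev (n + 1) t\<bar>) - integral {0..T} (\<lambda>t. \<bar>dev 1 t\<bar>) + T * c) {0..T}"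
    using has_integral_const_real[of c 0 T] \<open>T \<ge> 0\<close>
    by (intro has_integral_add has_integral_diff integrable_integral abs_dev_integrable) auto
  moreover have "\<Phi>' t \<le> \<bar>dev (n + 1) t\<bar> - \<bar>dev 1 t\<bar> + c" if "t \<in> {0..T}" for t
    unfolding \<Phi>'_def rate_def c_def
    using lam K_nonneg \<open>e > 0\<close> that fdev_same_sign fdev_lipschitz[of t] dev_0[of t] fdev_lipschitz[of t 0]
    by (intro smoothed_l1_dissipation) auto
  ultimately have "\<Phi> T - \<Phi> 0 \<le>
      integral {0..T} (\<lambda>t. \<bar>dev (n + 1) t\<bar>) - integral {0..T} (\<lambda>t. \<bar>dev 1 t\<bar>) + T * c"
    by (rule has_integral_le)
  moreover have "\<Phi> T \<ge> 0"
    unfolding \<Phi>_def by (intro sum_nonneg) auto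
  moreover have "\<Phi> 0 \<le> (\<Sum>i. \<bar>dev i 0\<bar>) + real n * e"
  proof -
    have "\<Phi> 0 \<le> (\<Sum>i=1..n. \<bar>dev i 0\<bar> + e)"
      unfolding \<Phi>_def
    proof (rule sum_mono)
      show "sqrt ((dev i 0)\<^sup>2 + e\<^sup>2) \<le> \<bar>dev i 0\<bar> + e" for i
        using sqrt_sum_squares_le_sum_abs[of "dev i 0" e] \<open>e > 0\<close> by simp
    qed
    also have "\<dots> = (\<Sum>i=1..n. \<bar>dev i 0\<bar>) + real n * e"
      by (simp add: sum.distrib)
    also have "(\<Sum>i=1..n. \<bar>dev i 0\<bar>) \<le> (\<Sum>i. \<bar>dev i 0\<bar>)"
      by (intro sum_le_suminf dev_summable) auto
    finally show ?thesis by simp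
  qed
  ultimately show ?thesis
    by (simp add: c_def algebra_simps)
qed

text \<open>
  Let \<open>n \<rightarrow> \<infinity>\<close> in the truncated bound. The inflow from level \<open>n + 1\<close> vanishes by dominated
  convergence, because every state is summable and deviations are at most \<open>1\<close>.
\<close>

lemma integral_abs_dev_1_le:
  assumes "T \<ge> 0"
  shows "integral {0..T} (\<lambda>t. \<bar>dev 1 t\<bar>) \<le> (\<Sum>i. \<bar>dev i 0\<bar>)"
proof -
  define C where "C = 1 + T * (K + 1)"
  have "C \<ge> 0" using assms K_nonneg by (auto simp: C_def)
  have "(\<lambda>n. integral {0..T} (\<lambda>t. \<bar>dev (n + 1) t\<bar>)) \<longlonglongrightarrow> integral {0..T} (\<lambda>t. 0)"
  proof (rule dominated_convergence(2))
    show "(\<lambda>t. \<bar>dev (n + 1) t\<bar>) integrable_on {0..T}" for n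
      by (rule abs_dev_integrable) simp
    show "(\<lambda>t. 1) integrable_on {0..T}" by (rule integrable_const_ivl)
    show "norm \<bar>dev (n + 1) t\<bar> \<le> 1" if "t \<in> {0..T}" for n t
      using dev_bound that by auto
    show "(\<lambda>n. \<bar>dev (n + 1) t\<bar>) \<longlonglongrightarrow> 0" if "t \<in> {0..T}" for t
      using LIMSEQ_ignore_initial_segment[OF summable_LIMSEQ_zero[OF dev_summable[of t]], of 1] that
      by simp
  qed
  then have "(\<lambda>n. (\<Sum>i. \<bar>dev i 0\<bar>) + integral {0..T} (\<lambda>t. \<bar>dev (n + 1) t\<bar>) + inverse (real (Suc n)) * C)
      \<longlonglongrightarrow> (\<Sum>i. \<bar>dev i 0\<bar>) + integral {0..T} (\<lambda>t. 0) + 0 * C"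
    by (intro tendsto_intros LIMSEQ_inverse_real_of_nat)
  moreover have "integral {0..T} (\<lambda>t. \<bar>dev 1 t\<bar>)
      \<le> (\<Sum>i. \<bar>dev i 0\<bar>) + integral {0..T} (\<lambda>t. \<bar>dev (n + 1) t\<bar>) + inverse (real (Suc n)) * C" for n
  proof -
    \<comment> \<open>The smoothing error grows with the number of levels, so \<open>e\<close> has to be of smaller order than \<open>1 / n\<close>.\<close>
    define e where "e = inverse (real (Suc n) * real (Suc n))"
    have "e > 0" by (simp add: e_def)
    have "real n * e \<le> real (Suc n) * e"
      using \<open>e > 0\<close> by (intro mult_right_mono) auto
    also have "\<dots> = inverse (real (Suc n))"
      by (simp add: e_def field_simps del: of_nat_Suc)
    finally have "real n * e * C \<le> inverse (real (Suc n)) * C"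
      using \<open>C \<ge> 0\<close> by (rule mult_right_mono)
    then show ?thesis
      using truncated_l1_dissipation[OF assms \<open>e > 0\<close>, of n] by (simp add: C_def)
  qed
  ultimately show ?thesis
    by (simp add: LIMSEQ_le_const)
qed

lemma dev_1_tendsto_0: "(dev 1 \<longlongrightarrow> 0) at_top"
proof -
  define F where "F T = integral {0..T} (\<lambda>t. \<bar>dev 1 t\<bar>)" for T
  have cont: "continuous_on {0..T} (\<lambda>t. \<bar>dev 1 t\<bar>)" for T
    by (intro continuous_intros continuous_on_subset[OF dev_continuous]) auto
  have "mono_on {0..} F"
    unfolding F_def by (intro mono_onI integral_subset_le abs_dev_integrable) auto
  moreover have "F T \<le> (\<Sum>i. \<bar>dev i 0\<bar>)" if "T \<ge> 0" for T
    unfolding F_def using that by (rule integral_abs_dev_1_le)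
  ultimately obtain L where L: "(F \<longlongrightarrow> L) at_top"
    by (rule mono_bounded_convergent_at_top)
  have "((\<lambda>t. \<bar>dev 1 t\<bar>) \<longlongrightarrow> 0) at_top"
  proof (rule barbalat[OF _ _ L])
    fix t :: real assume "t \<ge> 0"
    then have "(F has_real_derivative \<bar>dev 1 t\<bar>) (at t within {0..t + 1})"
      unfolding F_def using cont by (intro integral_has_real_derivative) auto
    moreover have "at t within {0..t + 1} = at t within {0..}"
      by (rule at_within_nhd[of t "{..<t + 1}"]) auto
    ultimately show "(F has_real_derivative \<bar>dev 1 t\<bar>) (at t within {0..})" by simp
  next
    have "2-lipschitz_on {0..} (\<lambda>t. \<bar>dev 1 t\<bar>)"
    proof (rule lipschitz_onI)
      fix s t :: real assume "s \<in> {0..}" "t \<in> {0..}"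
      then show "dist \<bar>dev 1 s\<bar> \<bar>dev 1 t\<bar> \<le> 2 * dist s t"
        using dev_lipschitz[of s t 1] by (auto simp: dist_real_def)
    qed simp
    then show "uniformly_continuous_on {0..} (\<lambda>t. \<bar>dev 1 t\<bar>)"
      by (rule lipschitz_on_uniformly_continuous)
  qed
  then show ?thesis by (rule tendsto_rabs_zero_cancel)
qed

lemma fdev_tendsto_0:
  assumes "(dev i \<longlongrightarrow> 0) at_top"
  shows "(fdev i \<longlongrightarrow> 0) at_top"
proof (rule Lim_null_comparison)
  show "\<forall>\<^sub>F t in at_top. norm (fdev i t) \<le> K * \<bar>dev i t\<bar>"
    using eventually_ge_at_top[of 0] by eventually_elim (simp add: fdev_lipschitz)
  show "((\<lambda>t. K * \<bar>dev i t\<bar>) \<longlongrightarrow> 0) at_top"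
    using tendsto_mult_right_zero[OF tendsto_rabs_zero[OF assms]] .
qed

text \<open>
  The induction hypothesis covers two consecutive levels, because the equation for \<open>x\<^sub>i\<close> involves
  both neighbours: once \<open>x\<^sub>i\<^sub>-\<^sub>1\<close> and \<open>x\<^sub>i\<close> vanish in the limit, so does \<open>x\<^sub>i'\<close>, and the equation
  leaves no room for \<open>x\<^sub>i\<^sub>+\<^sub>1\<close>.
\<close>

lemma dev_tendsto_0: "(dev i \<longlongrightarrow> 0) at_top"
proof -
  have "(dev i \<longlongrightarrow> 0) at_top \<and> (dev (Suc i) \<longlongrightarrow> 0) at_top"
  proof (induction i)
    case 0
    have "\<forall>\<^sub>F t in at_top. dev 0 t = 0"
      using eventually_ge_at_top[of 0] by eventually_elim (rule dev_0)
    then show ?case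
      using dev_1_tendsto_0 by (simp add: tendsto_eventually)
  next
    case (Suc i)
    have "(rate (Suc i) \<longlongrightarrow> 0) at_top"
      using Suc by (intro barbalat[OF dev_has_derivative rate_uniformly_continuous]) auto
    then have "((\<lambda>t. rate (Suc i) t - lam * (fdev i t - fdev (Suc i) t) + dev (Suc i) t)
        \<longlongrightarrow> 0 - lam * (0 - 0) + 0) at_top"
      using Suc by (intro tendsto_intros fdev_tendsto_0) auto
    moreover have "(\<lambda>t. rate (Suc i) t - lam * (fdev i t - fdev (Suc i) t) + dev (Suc i) t) = dev (Suc (Suc i))"
      by (simp add: rate_def fun_eq_iff)
    ultimately show ?case using Suc by simp
  qed
  then show ?thesis ..
qed

end

theorem proposition4:
  fixes lam :: real and p :: "nat \<Rightarrow> real" and q :: "real \<Rightarrow> nat \<Rightarrow> real"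
  assumes "0 < lam" and "lam < 1"
    and "\<And>d. p d \<in> {0..1}"
    and "p sums 1"
    and "summable (\<lambda>d. real d * p d)"
    and "fluid_trajectory lam (gen_fun p) q"
  shows "\<forall>i. ((\<lambda>t. q t i) \<longlongrightarrow> q_star lam (gen_fun p) i) at_top"
proof
  fix i
  interpret fluid_model lam p q
    using assms by unfold_locales auto
  have "((\<lambda>t. dev i t + qs i) \<longlongrightarrow> 0 + qs i) at_top"
    by (intro tendsto_intros dev_tendsto_0)
  then show "((\<lambda>t. q t i) \<longlongrightarrow> q_star lam (gen_fun p) i) at_top"
    by (simp add: dev_def)
qed

end
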